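(* Let $n\ge 1$, let $d\ge 2$ be an even integer, and let $\Vert\cdot\Vert:\mathcal{F}_{d,n}\to\mathbb{R}$ be a norm on the space of real $n$-variate forms of degree $d$. Consider the convex optimization problem $$\mathbf{P}_{\Vert\cdot\Vert}:\quad \mathrm{opt}_{\Vert\cdot\Vert}=\inf\{v(f):\ \Vert f\Vert\le 1,\ f\in\mathcal{F}_{d,n}\}.$$ Then: (1) The problem $\mathbf{P}_{\Vert\cdot\Vert}$ has a unique optimal solution $f^\star$, and $f^\star\in\mathcal{V}_{d,n}$. (2) If the norm $\Vert\cdot\Vert$ is $O(n)$-invariant, then $f^\star=b_{d,n}/\Vert b_{d,n}\Vert$, where $b_{d,n}(x)=|x|^d=(x_1^2+\dots+x_n^2)^{d/2}$, and $\mathrm{opt}_{\Vert\cdot\Vert}=\Vert b_{d,n}\Vert^{n/d}\,v(b_{d,n})$.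
   Context: $\mathcal{F}_{d,n}$ is the real vector space of real homogeneous polynomials (forms) of degree $d$ in $n$ variables (including $0$). For $f\in\mathcal{F}_{d,n}$, $v(f)=\mathrm{vol}\{x\in\mathbb{R}^n: f(x)\le 1\}\in[0,+\infty]$ is the Lebesgue volume of the sublevel set. $\mathcal{V}_{d,n}=\{f\in\mathcal{F}_{d,n}: v(f)<+\infty\}$. An optimal solution of $\mathbf{P}_{\Vert\cdot\Vert}$ is a form $f^\star\in\mathcal{F}_{d,n}$ with $\Vert f^\star\Vert\le 1$ and $v(f^\star)=\mathrm{opt}_{\Vert\cdot\Vert}$. The orthogonal group $O(n)=\{\rho\in\mathbb{R}^{n\times n}:\rho\rho^t=\mathrm{id}\}$ acts on $\mathcal{F}_{d,n}$ by $\rho^*f(x)=f(\rho^{-1}x)$; a norm $\Vert\cdot\Vert$ on $\mathcal{F}_{d,n}$ is $O(n)$-invariant if $\Vert\rho^*f\Vert=\Vert f\Vert$ for all $\rho\in O(n)$ and $f\in\mathcal{F}_{d,n}$. *)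

theory Defs
  imports "HOL-Analysis.Analysis"
begin

text \<open>Forms are represented by the functions they induce on \<^typ>\<open>real ^ 'n\<close>; since the reals are
  infinite, a polynomial is determined by its function. An exponent vector is a function
  \<^typ>\<open>'n \<Rightarrow> nat\<close>, and the number of variables is \<^term>\<open>CARD('n)\<close>.\<close>

definition exponents :: "nat \<Rightarrow> ('n::finite \<Rightarrow> nat) set" where
  "exponents d = {a. (\<Sum>i\<in>UNIV. a i) = d}"

definition forms :: "nat \<Rightarrow> (real ^ 'n::finite \<Rightarrow> real) set" where
  "forms d = {f. \<exists>c :: ('n \<Rightarrow> nat) \<Rightarrow> real.
                  f = (\<lambda>x. \<Sum>a\<in>exponents d. c a * (\<Prod>i\<in>UNIV. (x $ i) ^ a i))}"

lemma finite_exponents: "finite (exponents d :: ('n::finite \<Rightarrow> nat) set)"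
proof (rule finite_subset)
  show "(exponents d :: ('n \<Rightarrow> nat) set) \<subseteq> PiE UNIV (\<lambda>_. {..d})"
    by (auto simp: exponents_def PiE_def intro: member_le_sum)
qed (intro finite_PiE; simp)

definition vol :: "(real ^ 'n::finite \<Rightarrow> real) \<Rightarrow> ennreal" where
  "vol f = emeasure lebesgue {x. f x \<le> 1}"

definition finite_vol_forms :: "nat \<Rightarrow> (real ^ 'n::finite \<Rightarrow> real) set" where
  "finite_vol_forms d = {f \<in> forms d. vol f < \<infinity>}"

text \<open>Values of \<open>N\<close> outside \<^term>\<open>forms d\<close> are irrelevant.\<close>

definition norm_on_forms :: "nat \<Rightarrow> ((real ^ 'n::finite \<Rightarrow> real) \<Rightarrow> real) \<Rightarrow> bool" where
  "norm_on_forms d N \<longleftrightarrow>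
     (\<forall>f\<in>forms d. 0 \<le> N f \<and> (N f = 0 \<longleftrightarrow> f = (\<lambda>x. 0))) \<and>
     (\<forall>f\<in>forms d. \<forall>c::real. N (\<lambda>x. c * f x) = \<bar>c\<bar> * N f) \<and>
     (\<forall>f\<in>forms d. \<forall>g\<in>forms d. N (\<lambda>x. f x + g x) \<le> N f + N g)"

definition opt :: "nat \<Rightarrow> ((real ^ 'n::finite \<Rightarrow> real) \<Rightarrow> real) \<Rightarrow> ennreal" where
  "opt d N = (INF f\<in>{f \<in> forms d. N f \<le> 1}. vol f)"

definition optimal_solution ::
    "nat \<Rightarrow> ((real ^ 'n::finite \<Rightarrow> real) \<Rightarrow> real) \<Rightarrow> (real ^ 'n \<Rightarrow> real) \<Rightarrow> bool" where
  "optimal_solution d N f \<longleftrightarrow> f \<in> forms d \<and> N f \<le> 1 \<and> vol f = opt d N"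

definition pushforward :: "real ^ 'n ^ 'n \<Rightarrow> (real ^ 'n::finite \<Rightarrow> real) \<Rightarrow> (real ^ 'n \<Rightarrow> real)" where
  "pushforward \<rho> f = (\<lambda>x. f (matrix_inv \<rho> *v x))"

definition orthogonally_invariant ::
    "nat \<Rightarrow> ((real ^ 'n::finite \<Rightarrow> real) \<Rightarrow> real) \<Rightarrow> bool" where
  "orthogonally_invariant d N \<longleftrightarrow>
     (\<forall>\<rho>. orthogonal_matrix \<rho> \<longrightarrow> (\<forall>f\<in>forms d. N (pushforward \<rho> f) = N f))"

definition norm_power :: "nat \<Rightarrow> real ^ 'n::finite \<Rightarrow> real" where
  "norm_power d x = norm x ^ d"

end

theory Submission
  imports Defs
begin

text \<open>
  The proof rests on an integral representation of the volume. Let \<open>\<phi>(t)\<close> be \<open>1 - t\<close> clipped to the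
  interval from 0 to 1. By Tonelli's theorem the integral of \<open>\<phi> \<circ> f\<close> is the integral of the
  volumes of \<open>{f \<le> t}\<close> over \<open>t\<close> between 0 and 1, and homogeneity makes the volume of \<open>{f \<le> t}\<close> equal
  to \<open>t powr (n / d)\<close> times \<open>vol f\<close>. Hence \<open>\<integral> \<phi> \<circ> f = C * vol f\<close> with a constant \<open>0 < C < \<infinity>\<close> that depends
  only on \<open>n\<close> and \<open>d\<close> (\<open>integral_trunc_form\<close>). It is customary to use \<open>exp (- t)\<close> here; the compactly
  supported \<open>\<phi>\<close> serves equally well and keeps the computation of \<open>C\<close> trivial.

  Existence. Fatou's lemma and the continuity of \<open>\<phi>\<close> make \<open>vol\<close> lower semicontinuous under pointwise
  convergence (\<open>vol_lower_semicontinuous\<close>). Forms of degree \<open>d\<close> make up a finite-dimensional space, so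
  a minimizing sequence in the unit ball of the norm has a subsequence that converges pointwise to
  a form in that ball (\<open>unit_ball_compact\<close>), and the limit is optimal.

  Uniqueness. A form of finite volume is nonnegative, since otherwise it would be negative on a
  nonempty open cone (\<open>finite_vol_nonneg\<close>). On the nonnegative half-line \<open>\<phi>\<close> is convex, although
  not strictly. Strictness comes from homogeneity: where \<open>f x < g x\<close>, a rescaling of \<open>x\<close> achieves
  \<open>f x < 1 < g x\<close>, and the kink of \<open>\<phi>\<close> at 1 makes the convexity inequality strict. So the midpoint of
  two different optimal solutions would have smaller volume (\<open>vol_midpoint_less\<close>).

  Invariant norms. An orthogonal substitution preserves Lebesgue measure, so it turns the optimal
  solution into another one, which by uniqueness is the same. As the orthogonal group is
  transitive on spheres, the solution is a multiple \<open>c * norm_power d\<close>. The norm constraint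
  gives \<open>c \<le> 1 / N (norm_power d)\<close>, so the normalized power of the norm has at most the same volume,
  and it is the solution by uniqueness once more.
\<close>

section \<open>Forms\<close>

abbreviation monomial :: "('n \<Rightarrow> nat) \<Rightarrow> real ^ 'n::finite \<Rightarrow> real" where
  "monomial a x \<equiv> \<Prod>i\<in>UNIV. (x $ i) ^ a i"

lemma zero_in_forms: "(\<lambda>x. 0) \<in> forms d"
  unfolding forms_def by (rule CollectI, rule exI[of _ "\<lambda>_. 0"]) simp

lemma add_in_forms:
  assumes "f \<in> forms d" "g \<in> forms d"
  shows "(\<lambda>x. f x + g x) \<in> forms d"
proof -
  from assms obtain c e
    where "f = (\<lambda>x. \<Sum>a\<in>exponents d. c a * monomial a x)"
      and "g = (\<lambda>x. \<Sum>a\<in>exponents d. e a * monomial a x)"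
    unfolding forms_def by auto
  then have "(\<lambda>x. f x + g x) = (\<lambda>x. \<Sum>a\<in>exponents d. (c a + e a) * monomial a x)"
    by (simp add: sum.distrib distrib_right)
  then show ?thesis unfolding forms_def by (intro CollectI exI[of _ "\<lambda>a. c a + e a"])
qed

lemma scale_in_forms:
  assumes "f \<in> forms d"
  shows "(\<lambda>x. r * f x) \<in> forms d"
proof -
  from assms obtain c where "f = (\<lambda>x. \<Sum>a\<in>exponents d. c a * monomial a x)"
    unfolding forms_def by auto
  then have "(\<lambda>x. r * f x) = (\<lambda>x. \<Sum>a\<in>exponents d. (r * c a) * monomial a x)"
    by (simp add: sum_distrib_left mult.assoc)
  then show ?thesis unfolding forms_def by (intro CollectI exI[of _ "\<lambda>a. r * c a"])
qed

lemma sum_in_forms: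
  assumes "\<And>i. i \<in> I \<Longrightarrow> f i \<in> forms d"
  shows "(\<lambda>x. \<Sum>i\<in>I. f i x) \<in> forms d"
proof (cases "finite I")
  case True
  then show ?thesis using assms
    by (induction I) (auto simp: zero_in_forms add_in_forms)
qed (simp add: zero_in_forms)

lemma monomial_in_forms:
  fixes a :: "'n::finite \<Rightarrow> nat"
  assumes "a \<in> exponents d"
  shows "monomial a \<in> forms d"
proof -
  have "monomial a = (\<lambda>x. \<Sum>b\<in>exponents d. (if b = a then 1 else 0) * monomial b x)"
    using assms finite_exponents[of d, where 'n='n]
    by (simp add: if_distrib[of "\<lambda>u. u * _"] sum.delta cong: if_cong)
  then show ?thesis unfolding forms_def
    by (intro CollectI exI[of _ "\<lambda>b. if b = a then 1 else 0"])
qed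

lemma mult_in_forms:
  fixes f g :: "real ^ 'n::finite \<Rightarrow> real"
  assumes "f \<in> forms d" "g \<in> forms e"
  shows "(\<lambda>x. f x * g x) \<in> forms (d + e)"
proof -
  from assms obtain p q
    where f: "f = (\<lambda>x. \<Sum>a\<in>exponents d. p a * monomial a x)"
      and g: "g = (\<lambda>x. \<Sum>b\<in>exponents e. q b * monomial b x)"
    unfolding forms_def by auto
  have "(\<lambda>x. f x * g x) =
    (\<lambda>x. \<Sum>a\<in>exponents d. \<Sum>b\<in>exponents e. (p a * q b) * monomial (\<lambda>i. a i + b i) x)"
    unfolding f g sum_product
    by (simp add: power_add prod.distrib mult_ac)
  also have "\<dots> \<in> forms (d + e)"
    by (intro sum_in_forms scale_in_forms monomial_in_forms) (auto simp: exponents_def sum.distrib)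
  finally show ?thesis .
qed

lemma one_in_forms: "(\<lambda>x. 1) \<in> forms 0"
  using monomial_in_forms[of "\<lambda>_. 0" 0] by (simp add: exponents_def)

lemma power_in_forms:
  assumes "f \<in> forms d"
  shows "(\<lambda>x. f x ^ k) \<in> forms (k * d)"
  by (induction k) (use mult_in_forms[OF assms] one_in_forms in auto)

lemma prod_in_forms:
  assumes "finite I" "\<And>i. i \<in> I \<Longrightarrow> f i \<in> forms (e i)"
  shows "(\<lambda>x. \<Prod>i\<in>I. f i x) \<in> forms (\<Sum>i\<in>I. e i)"
  using assms
  by (induction I) (auto simp: one_in_forms mult_in_forms)

lemma coordinate_in_forms: "(\<lambda>x::real ^ 'n::finite. x $ j) \<in> forms 1"
proof -
  have "monomial (\<lambda>i. if i = j then 1 else 0) = (\<lambda>x::real ^ 'n. x $ j)"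
    by (simp add: if_distrib[of "\<lambda>u. _ ^ u"] prod.delta cong: if_cong)
  moreover have "(\<lambda>i::'n. if i = j then 1 else 0) \<in> exponents 1"
    by (simp add: exponents_def)
  ultimately show ?thesis using monomial_in_forms[of "\<lambda>i. if i = j then 1 else 0" 1] by (simp only:)
qed

lemma norm_power_in_forms:
  assumes "even d"
  shows "norm_power d \<in> forms d"
proof -
  obtain k where d: "d = 2 * k" using assms by (elim evenE)
  have "(norm_power d :: real ^ 'n::finite \<Rightarrow> real) = (\<lambda>x. (\<Sum>i\<in>UNIV. (x $ i) ^ 2) ^ k)"
    by (simp add: fun_eq_iff norm_power_def d power_mult norm_vec_def L2_set_def sum_nonneg)
  also have "\<dots> \<in> forms (k * 2)"
    using power_in_forms[OF coordinate_in_forms, where k=2]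
    by (intro power_in_forms sum_in_forms) simp
  finally show ?thesis by (simp add: d mult.commute)
qed

text \<open>Each factor of a monomial becomes a power of a linear form, and products of forms are forms.\<close>

lemma linear_substitution_in_forms:
  fixes M :: "real ^ 'n::finite ^ 'n"
  assumes "f \<in> forms d"
  shows "(\<lambda>x. f (M *v x)) \<in> forms d"
proof -
  from assms obtain c where f: "f = (\<lambda>x. \<Sum>a\<in>exponents d. c a * monomial a x)"
    unfolding forms_def by auto
  have "(\<lambda>x. monomial a (M *v x)) \<in> forms d" if "a \<in> exponents d" for a
  proof -
    have "(\<lambda>x. (M *v x) $ i) \<in> forms 1" for i
      unfolding matrix_vector_mult_def vec_lambda_beta
      by (intro sum_in_forms scale_in_forms coordinate_in_forms)
    from power_in_forms[OF this] have "(\<lambda>x. (M *v x) $ i ^ a i) \<in> forms (a i)" for i by simp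
    then have "(\<lambda>x. monomial a (M *v x)) \<in> forms (\<Sum>i\<in>UNIV. a i)"
      by (intro prod_in_forms) auto
    then show ?thesis using that by (simp add: exponents_def)
  qed
  then show ?thesis unfolding f by (intro sum_in_forms scale_in_forms)
qed

lemma forms_homogeneous:
  assumes "f \<in> forms d"
  shows "f (r *\<^sub>R x) = r ^ d * f x"
proof -
  from assms obtain c where f: "f = (\<lambda>x. \<Sum>a\<in>exponents d. c a * monomial a x)"
    unfolding forms_def by auto
  have "monomial a (r *\<^sub>R x) = r ^ d * monomial a x" if "a \<in> exponents d" for a
    using that by (simp add: exponents_def power_mult_distrib prod.distrib flip: power_sum)
  then show ?thesis unfolding f by (simp add: sum_distrib_left mult_ac)
qed

lemma continuous_on_forms:
  assumes "f \<in> forms d"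
  shows "continuous_on UNIV f"
proof -
  from assms obtain c where f: "f = (\<lambda>x. \<Sum>a\<in>exponents d. c a * monomial a x)"
    unfolding forms_def by auto
  show ?thesis unfolding f by (intro continuous_intros)
qed

lemma borel_measurable_forms: "f \<in> forms d \<Longrightarrow> f \<in> borel_measurable borel"
  by (rule borel_measurable_continuous_onI[OF continuous_on_forms])

section \<open>Compactness of the unit ball of a norm\<close>

lemma bounded_family_convergent_subseq:
  fixes c :: "nat \<Rightarrow> 'b \<Rightarrow> real"
  assumes "finite A" "\<And>k a. a \<in> A \<Longrightarrow> \<bar>c k a\<bar> \<le> B"
  shows "\<exists>r l. strict_mono r \<and> (\<forall>a\<in>A. (\<lambda>k. c (r k) a) \<longlonglongrightarrow> l a)"
  using assms
proof (induction A)
  case empty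
  then show ?case by (auto simp: strict_mono_def intro: exI[of _ id])
next
  case (insert b A)
  then obtain r l where r: "strict_mono r" "\<forall>a\<in>A. (\<lambda>k. c (r k) a) \<longlonglongrightarrow> l a" by auto
  have "bounded (range (\<lambda>k. c (r k) b))"
    using insert.prems by (auto simp: bounded_iff)
  then obtain m s where s: "strict_mono s" "((\<lambda>k. c (r k) b) \<circ> s) \<longlonglongrightarrow> m"
    using bounded_imp_convergent_subsequence by blast
  have "(\<lambda>k. c (r (s k)) a) \<longlonglongrightarrow> l a" if "a \<in> A" for a
    using LIMSEQ_subseq_LIMSEQ[OF _ s(1)] r(2) that by (auto simp: comp_def)
  with s insert.hyps have "\<forall>a\<in>insert b A. (\<lambda>k. c ((r \<circ> s) k) a) \<longlonglongrightarrow> (l(b := m)) a"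
    by (auto simp: comp_def)
  with strict_mono_o[OF r(1) s(1)] show ?case by blast
qed

text \<open>A spanning set of monomials of least cardinality is linearly independent: a monomial with a nonzero
  coefficient in a vanishing combination could be expressed by the others and dropped. This bypasses
  the identity theorem for polynomials.\<close>

lemma forms_basis:
  obtains A :: "('n::finite \<Rightarrow> nat) set"
  where "finite A" "A \<subseteq> exponents d"
    "\<And>f. f \<in> forms d \<Longrightarrow> \<exists>c. f = (\<lambda>x. \<Sum>a\<in>A. c a * monomial a x)"
    "\<And>c a. (\<lambda>x. \<Sum>a\<in>A. c a * monomial a x) = (\<lambda>x. 0) \<Longrightarrow> a \<in> A \<Longrightarrow> c a = 0"
proof -
  define S where "S A \<longleftrightarrow> A \<subseteq> exponents d \<and>
      (\<forall>f\<in>forms d. \<exists>c. f = (\<lambda>x. \<Sum>a\<in>A. c a * monomial a x))" for A :: "('n \<Rightarrow> nat) set"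
  have "S (exponents d)" by (auto simp: S_def forms_def)
  then obtain A where A: "S A" and minimal: "\<And>A'. S A' \<Longrightarrow> card A \<le> card A'"
    using ex_has_least_nat[of S "exponents d" card] by auto
  have "finite A" using A finite_exponents finite_subset unfolding S_def by blast
  have "c b = 0" if 0: "(\<lambda>x. \<Sum>a\<in>A. c a * monomial a x) = (\<lambda>x. 0)" and b: "b \<in> A" for c b
  proof (rule ccontr)
    assume "c b \<noteq> 0"
    have mono_b: "monomial b x = - (\<Sum>a\<in>A - {b}. c a / c b * monomial a x)" for x
    proof -
      have "c b * monomial b x + (\<Sum>a\<in>A - {b}. c a * monomial a x) = 0"
        using fun_cong[OF 0, of x] sum.remove[OF \<open>finite A\<close> b, of "\<lambda>a. c a * monomial a x"] by simp
      then have "monomial b x = - (\<Sum>a\<in>A - {b}. c a * monomial a x) / c b"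
        using \<open>c b \<noteq> 0\<close> by (simp add: field_simps)
      then show ?thesis by (simp add: sum_divide_distrib)
    qed
    have "\<exists>e. f = (\<lambda>x. \<Sum>a\<in>A - {b}. e a * monomial a x)" if "f \<in> forms d" for f
    proof -
      obtain e where e: "f = (\<lambda>x. \<Sum>a\<in>A. e a * monomial a x)" using A \<open>f \<in> forms d\<close> by (auto simp: S_def)
      have "f x = (\<Sum>a\<in>A - {b}. (e a - e b * c a / c b) * monomial a x)" for x
      proof -
        have "f x = e b * monomial b x + (\<Sum>a\<in>A - {b}. e a * monomial a x)"
          unfolding e using sum.remove[OF \<open>finite A\<close> b] by blast
        also have "\<dots> = (\<Sum>a\<in>A - {b}. e a * monomial a x - e b * (c a / c b * monomial a x))"
          unfolding mono_b by (simp add: sum_distrib_left sum_subtractf)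
        also have "\<dots> = (\<Sum>a\<in>A - {b}. (e a - e b * c a / c b) * monomial a x)"
          by (simp add: left_diff_distrib mult.assoc)
        finally show ?thesis .
      qed
      then show ?thesis by (intro exI[of _ "\<lambda>a. e a - e b * c a / c b"] ext)
    qed
    then have "S (A - {b})" using A by (auto simp: S_def)
    from minimal[OF this] show False
      using card_Diff1_less[OF \<open>finite A\<close> b] by simp
  qed
  with A \<open>finite A\<close> show thesis unfolding S_def by (intro that[of A]) auto
qed

context
  fixes d :: nat and N :: "(real ^ 'n::finite \<Rightarrow> real) \<Rightarrow> real"
  assumes N: "norm_on_forms d N"
begin

lemma norm_nonneg: "f \<in> forms d \<Longrightarrow> 0 \<le> N f"
  and norm_eq_0_iff: "f \<in> forms d \<Longrightarrow> N f = 0 \<longleftrightarrow> f = (\<lambda>x. 0)"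
  and norm_scale: "f \<in> forms d \<Longrightarrow> N (\<lambda>x. r * f x) = \<bar>r\<bar> * N f"
  and norm_triangle: "f \<in> forms d \<Longrightarrow> g \<in> forms d \<Longrightarrow> N (\<lambda>x. f x + g x) \<le> N f + N g"
  using N unfolding norm_on_forms_def by blast+

lemma norm_combination_le:
  assumes "\<And>i. i \<in> I \<Longrightarrow> f i \<in> forms d"
  shows "N (\<lambda>x. \<Sum>i\<in>I. c i * f i x) \<le> (\<Sum>i\<in>I. \<bar>c i\<bar> * N (f i))"
proof (cases "finite I")
  case True
  then show ?thesis using assms
  proof (induction I)
    case empty
    then show ?case using norm_eq_0_iff[OF zero_in_forms] by simp
  next
    case (insert i I)
    have "N (\<lambda>x. c i * f i x + (\<Sum>j\<in>I. c j * f j x)) \<le>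
        N (\<lambda>x. c i * f i x) + N (\<lambda>x. \<Sum>j\<in>I. c j * f j x)"
      using insert.prems by (intro norm_triangle sum_in_forms scale_in_forms) auto
    with insert show ?case by (simp add: norm_scale)
  qed
qed (use norm_eq_0_iff[OF zero_in_forms] in simp)

text \<open>The triangle inequality bounds the norm of the limit by the norm of the \<open>k\<close>-th form plus a
  weighted \<open>\<ell>\<^sup>1\<close> distance of the coefficients, which tends to 0.\<close>

lemma norm_le_of_coefficient_limit:
  assumes A: "A \<subseteq> exponents d" and conv: "\<And>a. a \<in> A \<Longrightarrow> (\<lambda>k. e k a) \<longlonglongrightarrow> l a"
    and le: "\<And>k. N (\<lambda>x. \<Sum>a\<in>A. e k a * monomial a x) \<le> u k" and u: "u \<longlonglongrightarrow> m"
  shows "N (\<lambda>x. \<Sum>a\<in>A. l a * monomial a x) \<le> m"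
proof (rule LIMSEQ_le_const)
  have form: "(\<lambda>x. \<Sum>a\<in>A. c a * monomial a x) \<in> forms d" for c
    using A by (intro sum_in_forms scale_in_forms monomial_in_forms) auto
  have "(\<lambda>k. u k + (\<Sum>a\<in>A. \<bar>l a - e k a\<bar> * N (monomial a)))
      \<longlonglongrightarrow> m + (\<Sum>a\<in>A. \<bar>l a - l a\<bar> * N (monomial a))"
    by (intro tendsto_intros u conv)
  then show "(\<lambda>k. u k + (\<Sum>a\<in>A. \<bar>l a - e k a\<bar> * N (monomial a))) \<longlonglongrightarrow> m" by simp
  have "N (\<lambda>x. \<Sum>a\<in>A. l a * monomial a x) \<le> u k + (\<Sum>a\<in>A. \<bar>l a - e k a\<bar> * N (monomial a))" for k
  proof -
    have "(\<lambda>x. \<Sum>a\<in>A. l a * monomial a x) =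
        (\<lambda>x. (\<Sum>a\<in>A. e k a * monomial a x) + (\<Sum>a\<in>A. (l a - e k a) * monomial a x))"
      by (simp add: sum.distrib[symmetric] distrib_right[symmetric])
    then have "N (\<lambda>x. \<Sum>a\<in>A. l a * monomial a x) \<le>
        N (\<lambda>x. \<Sum>a\<in>A. e k a * monomial a x) + N (\<lambda>x. \<Sum>a\<in>A. (l a - e k a) * monomial a x)"
      using norm_triangle[OF form form] by simp
    also have "\<dots> \<le> u k + (\<Sum>a\<in>A. \<bar>l a - e k a\<bar> * N (monomial a))"
      using A by (intro add_mono le norm_combination_le monomial_in_forms) auto
    finally show ?thesis .
  qed
  then show "\<exists>n0. \<forall>k\<ge>n0. N (\<lambda>x. \<Sum>a\<in>A. l a * monomial a x)
      \<le> u k + (\<Sum>a\<in>A. \<bar>l a - e k a\<bar> * N (monomial a))" by blast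
qed

text \<open>All norms on a finite-dimensional space are equivalent. If the bound failed, there would be coefficient families of
  \<open>\<ell>\<^sup>1\<close> norm 1 whose forms have norms tending to 0. A subsequence of them converges, and its limit has
  \<open>\<ell>\<^sup>1\<close> norm 1 but represents the zero form, contrary to independence.\<close>

lemma coefficients_bounded_by_norm:
  assumes "finite A" and A: "A \<subseteq> exponents d"
    and indep: "\<And>c a. (\<lambda>x::real ^ 'n. \<Sum>a\<in>A. c a * monomial a x) = (\<lambda>x. 0) \<Longrightarrow> a \<in> A \<Longrightarrow> c a = 0"
  shows "\<exists>B. \<forall>c. (\<Sum>a\<in>A. \<bar>c a\<bar>) \<le> B * N (\<lambda>x. \<Sum>a\<in>A. c a * monomial a x)"
proof (rule ccontr)
  let ?P = "\<lambda>c x. \<Sum>a\<in>A. c a * monomial a x"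
  have form: "?P c \<in> forms d" for c
    using A by (intro sum_in_forms scale_in_forms monomial_in_forms) auto
  assume "\<not> ?thesis"
  then have "\<exists>c. (\<Sum>a\<in>A. \<bar>c a\<bar>) > real (Suc k) * N (?P c)" for k
    by (simp add: not_le)
  then have "\<forall>k. \<exists>c. (\<Sum>a\<in>A. \<bar>c a\<bar>) > real (Suc k) * N (?P c)" by blast
  from choice[OF this]
  obtain c where c: "\<And>k. (\<Sum>a\<in>A. \<bar>c k a\<bar>) > real (Suc k) * N (?P (c k))" by blast
  define s where "s k = (\<Sum>a\<in>A. \<bar>c k a\<bar>)" for k
  have s: "s k > 0" for k
    using c[of k] norm_nonneg[OF form, of "c k"] mult_nonneg_nonneg[of "real (Suc k)" "N (?P (c k))"]
    unfolding s_def by linarith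
  define e where "e k a = inverse (s k) * c k a" for k a
  have sum_e: "(\<Sum>a\<in>A. \<bar>e k a\<bar>) = 1" for k
    using s[of k] unfolding e_def abs_mult sum_distrib_left[symmetric]
    by (simp add: s_def[symmetric])
  have "\<bar>e k a\<bar> \<le> 1" if "a \<in> A" for k a
    using member_le_sum[of a A "\<lambda>a. \<bar>e k a\<bar>"] that \<open>finite A\<close> sum_e by auto
  from bounded_family_convergent_subseq[OF \<open>finite A\<close>, of e 1, OF this]
  obtain r l where r: "strict_mono r" and l: "\<And>a. a \<in> A \<Longrightarrow> (\<lambda>k. e (r k) a) \<longlonglongrightarrow> l a"
    by blast
  have le: "N (?P (e k)) \<le> 1 / real (Suc k)" for k
  proof -
    have "?P (e k) = (\<lambda>x. inverse (s k) * ?P (c k) x)"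
      by (simp add: e_def sum_distrib_left mult.assoc)
    then have "N (?P (e k)) = inverse (s k) * N (?P (c k))"
      using norm_scale[OF form, of "inverse (s k)" "c k"] s[of k] by simp
    also have "\<dots> \<le> inverse (s k) * (s k / real (Suc k))"
      using s[of k] c[of k] by (intro mult_left_mono) (simp_all add: s_def[symmetric] field_simps)
    finally show ?thesis using s[of k] by simp
  qed
  have "(\<lambda>k. 1 / real (Suc (r k))) \<longlonglongrightarrow> 0"
    using LIMSEQ_subseq_LIMSEQ[OF LIMSEQ_inverse_real_of_nat r] by (simp add: comp_def inverse_eq_divide)
  with norm_le_of_coefficient_limit[OF A l le] have "N (?P l) \<le> 0" by blast
  with norm_nonneg[OF form] norm_eq_0_iff[OF form] have "?P l = (\<lambda>x. 0)"
    by (meson order_antisym)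
  then have "(\<Sum>a\<in>A. \<bar>l a\<bar>) = 0" using indep[of l] by (intro sum.neutral) simp
  moreover have "(\<lambda>k. \<Sum>a\<in>A. \<bar>e (r k) a\<bar>) \<longlonglongrightarrow> (\<Sum>a\<in>A. \<bar>l a\<bar>)"
    by (intro tendsto_intros l)
  ultimately have "(\<lambda>k::nat. 1::real) \<longlonglongrightarrow> 0" by (simp add: sum_e)
  then show False using LIMSEQ_unique tendsto_const zero_neq_one by blast
qed

lemma unit_ball_compact:
  fixes F :: "nat \<Rightarrow> real ^ 'n \<Rightarrow> real"
  assumes F: "\<And>k. F k \<in> forms d" "\<And>k. N (F k) \<le> 1"
  obtains f r where "f \<in> forms d" "N f \<le> 1" "strict_mono r" "\<And>x. (\<lambda>k. F (r k) x) \<longlonglongrightarrow> f x"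
proof -
  obtain A :: "('n \<Rightarrow> nat) set" where A: "finite A" "A \<subseteq> exponents d"
    and span: "\<And>f. f \<in> forms d \<Longrightarrow> \<exists>c. f = (\<lambda>x. \<Sum>a\<in>A. c a * monomial a x)"
    and indep: "\<And>c a. (\<lambda>x. \<Sum>a\<in>A. c a * monomial a x) = (\<lambda>x. 0) \<Longrightarrow> a \<in> A \<Longrightarrow> c a = 0"
    using forms_basis by blast
  let ?P = "\<lambda>c x. \<Sum>a\<in>A. c a * monomial a x"
  have "\<forall>k. \<exists>c. F k = ?P c" using span[OF F(1)] by blast
  from choice[OF this] obtain c where c: "\<And>k. F k = ?P (c k)" by blast
  obtain B where B: "\<And>c. (\<Sum>a\<in>A. \<bar>c a\<bar>) \<le> B * N (?P c)"
    using coefficients_bounded_by_norm[OF A] indep by meson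
  have "\<bar>c k a\<bar> \<le> \<bar>B\<bar>" if "a \<in> A" for k a
  proof -
    have "\<bar>c k a\<bar> \<le> (\<Sum>a\<in>A. \<bar>c k a\<bar>)"
      using member_le_sum[of a A "\<lambda>a. \<bar>c k a\<bar>"] that A(1) by auto
    also have "\<dots> \<le> B * N (F k)" using B c by simp
    also have "\<dots> \<le> \<bar>B\<bar> * 1"
      using F norm_nonneg[OF F(1)] by (intro mult_mono) auto
    finally show ?thesis by simp
  qed
  from bounded_family_convergent_subseq[OF A(1), of c "\<bar>B\<bar>", OF this]
  obtain r l where r: "strict_mono r" and l: "\<And>a. a \<in> A \<Longrightarrow> (\<lambda>k. c (r k) a) \<longlonglongrightarrow> l a" by blast
  show thesis
  proof (rule that[OF _ _ r])
    show "?P l \<in> forms d"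
      using A by (intro sum_in_forms scale_in_forms monomial_in_forms) auto
    show "N (?P l) \<le> 1"
      by (rule norm_le_of_coefficient_limit[OF A(2) l _ tendsto_const]) (use F(2) in \<open>simp_all flip: c\<close>)
    show "(\<lambda>k. F (r k) x) \<longlonglongrightarrow> ?P l x" for x
      unfolding c by (intro tendsto_intros l)
  qed
qed

end

section \<open>Volumes of sublevel sets\<close>

lemma borel_sublevel: "f \<in> forms d \<Longrightarrow> {x. f x \<le> r} \<in> sets borel"
  by (intro borel_closed closed_Collect_le continuous_on_forms continuous_on_const)

lemma vol_lborel: "f \<in> forms d \<Longrightarrow> vol f = emeasure lborel {x. f x \<le> 1}"
  unfolding vol_def using borel_sublevel[of f d 1] by simp

lemma emeasure_sublevel:
  fixes f :: "real ^ 'n::finite \<Rightarrow> real"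
  assumes f: "f \<in> forms d" and "d > 0" "t > 0"
  shows "emeasure lborel {x. f x \<le> t} = ennreal (t powr (real CARD('n) / real d)) * vol f"
proof -
  define s where "s = t powr (1 / real d)"
  have s: "s > 0" "s ^ d = t"
    using assms by (simp_all add: s_def powr_powr flip: powr_realpow)
  have "{x. f x \<le> t} = (\<lambda>x. s *\<^sub>R x + 0) ` {x. f x \<le> 1}"
  proof (intro equalityI subsetI)
    fix x assume "x \<in> {x. f x \<le> t}"
    then have "f (inverse s *\<^sub>R x) \<le> 1"
      using s \<open>t > 0\<close> by (simp add: forms_homogeneous[OF f] power_inverse field_simps)
    then show "x \<in> (\<lambda>x. s *\<^sub>R x + 0) ` {x. f x \<le> 1}"
      using s by (intro image_eqI[of _ _ "inverse s *\<^sub>R x"]) auto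
  qed (use s \<open>t > 0\<close> in \<open>auto simp: forms_homogeneous[OF f]\<close>)
  then have "emeasure lebesgue {x. f x \<le> t} = \<bar>s\<bar> ^ DIM(real ^ 'n) * emeasure lebesgue {x. f x \<le> 1}"
    using emeasure_lebesgue_affine[of s 0 "{x. f x \<le> 1}"] by simp
  also have "\<bar>s\<bar> ^ DIM(real ^ 'n) = t powr (real CARD('n) / real d)"
    using s(1) \<open>t > 0\<close> unfolding s_def by (simp add: powr_powr flip: powr_realpow)
  finally show ?thesis using borel_sublevel[OF f, of t] by (simp add: vol_def)
qed

text \<open>The open set where \<open>f\<close> is negative is invariant under doubling, which multiplies its measure by
  \<open>2 ^ n\<close>. A finite measure must then vanish, so the set is empty.\<close>

lemma finite_vol_nonneg:
  fixes f :: "real ^ 'n::finite \<Rightarrow> real"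
  assumes f: "f \<in> forms d" and fin: "vol f < \<infinity>"
  shows "0 \<le> f x"
proof (rule ccontr)
  assume neg: "\<not> 0 \<le> f x"
  define U where "U = {x. f x < 0}"
  have "open U" unfolding U_def
    by (intro open_Collect_less continuous_on_forms[OF f] continuous_on_const)
  have "emeasure lebesgue U \<le> vol f"
    unfolding vol_def U_def using borel_sublevel[OF f, of 1] by (intro emeasure_mono) auto
  then have U: "U \<in> lmeasurable"
    using fin \<open>open U\<close> by (intro fmeasurableI) auto
  have "(\<lambda>x. 2 *\<^sub>R x + 0) ` U = U"
  proof (intro equalityI subsetI)
    fix x assume "x \<in> U"
    then show "x \<in> (\<lambda>x. 2 *\<^sub>R x + 0) ` U"
      using forms_homogeneous[OF f, of "1/2" x]
      by (intro image_eqI[of _ _ "(1/2) *\<^sub>R x"]) (auto simp: U_def mult_less_0_iff)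
  qed (auto simp: U_def forms_homogeneous[OF f] mult_less_0_iff)
  then have "measure lebesgue U = 2 ^ CARD('n) * measure lebesgue U"
    using measure_lebesgue_affine[of 2 0 U] by simp
  moreover have "(2::real) ^ CARD('n) > 1" by (intro one_less_power) auto
  ultimately have "measure lebesgue U = 0" by auto
  then have "negligible U" using U by (simp add: negligible_iff_measure)
  then show False using open_not_negligible[OF \<open>open U\<close>] neg by (auto simp: U_def not_le)
qed

section \<open>The volume as the integral of a convex function of the form\<close>

text \<open>The upper cut-off at 1 makes the layer formula below hold also at points where a form is negative;
  the function is then no longer convex on the whole line, but it is on the nonnegative half-line.\<close>

definition trunc :: "real \<Rightarrow> real" where
  "trunc t = max 0 (min 1 (1 - t))"

lemma trunc_nonneg: "0 \<le> trunc t"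
  by (simp add: trunc_def)

lemma continuous_on_trunc: "continuous_on A trunc"
  unfolding trunc_def by (intro continuous_intros)

lemma borel_measurable_trunc [measurable]: "trunc \<in> borel_measurable borel"
  by (rule borel_measurable_continuous_onI[OF continuous_on_trunc])

lemma trunc_midpoint_le:
  assumes "0 \<le> a" "0 \<le> b" "2 * m = a + b"
  shows "2 * trunc m \<le> trunc a + trunc b"
  using assms by (auto simp: trunc_def max_def min_def)

lemma trunc_midpoint_less:
  assumes "0 \<le> a" "a < 1" "1 < b" "2 * m = a + b"
  shows "2 * trunc m < trunc a + trunc b"
  using assms by (auto simp: trunc_def max_def min_def)

lemma trunc_layers:
  "(\<integral>\<^sup>+t. indicator {0<..<1} t * indicator {y..} t \<partial>lborel) = ennreal (trunc y)"
proof -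
  have "(\<integral>\<^sup>+t. indicator {0<..<1} t * indicator {y..} t \<partial>lborel)
      = emeasure lborel ({0<..<1} \<inter> {y..} :: real set)"
    by (simp flip: indicator_inter_arith)
  also have "{0<..<1} \<inter> {y..} = (if y \<le> 0 then {0<..<1} else {y..<1})" by auto
  also have "emeasure lborel \<dots> = ennreal (trunc y)" by (cases "y < 1") (auto simp: trunc_def)
  finally show ?thesis .
qed

lemma integral_trunc_form:
  assumes "d > 0"
  obtains C :: ennreal where "0 < C" "C < \<infinity>"
    "\<And>f :: real ^ 'n::finite \<Rightarrow> real. f \<in> forms d \<Longrightarrow> (\<integral>\<^sup>+x. ennreal (trunc (f x)) \<partial>lborel) = C * vol f"
proof
  let ?p = "real CARD('n) / real d"
  define C where "C = (\<integral>\<^sup>+t. indicator {0<..<1::real} t * ennreal (t powr ?p) \<partial>lborel)"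
  have "C \<le> (\<integral>\<^sup>+t. indicator {0<..<1::real} t \<partial>lborel)"
    unfolding C_def by (intro nn_integral_mono) (auto simp: indicator_def powr_le1)
  then show "C < \<infinity>" by (simp add: order_le_less_trans)
  have "0 < ennreal ((1 / 2) powr ?p) * ennreal (1 / 2)"
    by (simp add: ennreal_zero_less_mult_iff zero_less_iff_neq_zero)
  also have "\<dots> = (\<integral>\<^sup>+t. ennreal ((1 / 2) powr ?p) * indicator {1/2<..<1::real} t \<partial>lborel)"
    by (subst nn_integral_cmult_indicator) auto
  also have "\<dots> \<le> C"
    unfolding C_def
    by (intro nn_integral_mono) (auto simp: indicator_def intro!: ennreal_leI powr_mono2)
  finally show "0 < C" .
  fix f :: "real ^ 'n \<Rightarrow> real" assume f: "f \<in> forms d"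
  note [measurable] = borel_measurable_forms[OF f]
  have "(\<integral>\<^sup>+x. ennreal (trunc (f x)) \<partial>lborel) =
      (\<integral>\<^sup>+x. (\<integral>\<^sup>+t. indicator {0<..<1} t * indicator {f x..} t \<partial>lborel) \<partial>lborel)"
    by (simp add: trunc_layers)
  also have "\<dots> = (\<integral>\<^sup>+t. (\<integral>\<^sup>+x. indicator {0<..<1} t * indicator {f x..} t \<partial>lborel) \<partial>lborel)"
    by (intro lborel_pair.Fubini'[symmetric]) (simp add: indicator_def case_prod_unfold, measurable)
  also have "\<dots> = (\<integral>\<^sup>+t. indicator {0<..<1} t * ennreal (t powr ?p) * vol f \<partial>lborel)"
  proof (intro nn_integral_cong)
    fix t :: real
    have "(\<integral>\<^sup>+x. indicator {0<..<1} t * indicator {f x..} t \<partial>lborel) =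
        (\<integral>\<^sup>+x. indicator {0<..<1} t * indicator {x. f x \<le> t} x \<partial>lborel)"
      by (intro nn_integral_cong) (auto simp: indicator_def)
    also have "\<dots> = indicator {0<..<1} t * emeasure lborel {x. f x \<le> t}"
      by (subst nn_integral_cmult_indicator) auto
    also have "\<dots> = indicator {0<..<1} t * ennreal (t powr ?p) * vol f"
      using emeasure_sublevel[OF f assms, of t] by (auto simp: indicator_def)
    finally show "(\<integral>\<^sup>+x. indicator {0<..<1} t * indicator {f x..} t \<partial>lborel) =
        indicator {0<..<1} t * ennreal (t powr ?p) * vol f" .
  qed
  also have "\<dots> = C * vol f"
    unfolding C_def by (rule nn_integral_multc) measurable
  finally show "(\<integral>\<^sup>+x. ennreal (trunc (f x)) \<partial>lborel) = C * vol f" .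
qed

text \<open>The defect \<open>D\<close> of midpoint convexity is continuous and nonnegative, so its integral is positive as
  soon as \<open>D\<close> is positive at one point. Such a point arises by scaling one where \<open>f\<close> and \<open>g\<close> differ.\<close>

lemma vol_midpoint_less:
  fixes f g :: "real ^ 'n::finite \<Rightarrow> real"
  assumes f: "f \<in> forms d" and g: "g \<in> forms d" and "d > 0"
    and fin: "vol f < \<infinity>" "vol g < \<infinity>" and "f \<noteq> g"
  shows "2 * vol (\<lambda>x. (f x + g x) / 2) < vol f + vol g"
proof -
  let ?h = "\<lambda>x. (f x + g x) / 2"
  have h: "?h \<in> forms d" using scale_in_forms[OF add_in_forms[OF f g], of "1 / 2"] by simp
  note [measurable] = borel_measurable_forms[OF f] borel_measurable_forms[OF g]
  note nonneg = finite_vol_nonneg[OF f fin(1)] finite_vol_nonneg[OF g fin(2)]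
  obtain C :: ennreal where C: "0 < C" "C < \<infinity>"
    and int: "\<And>f :: real ^ 'n \<Rightarrow> real. f \<in> forms d \<Longrightarrow> (\<integral>\<^sup>+x. ennreal (trunc (f x)) \<partial>lborel) = C * vol f"
    using integral_trunc_form[OF \<open>d > 0\<close>] by metis
  define D where "D x = trunc (f x) + trunc (g x) - 2 * trunc (?h x)" for x
  have [measurable]: "D \<in> borel_measurable borel" unfolding D_def by measurable
  have D: "0 \<le> D x" for x
    using trunc_midpoint_le[OF nonneg(1)[of x] nonneg(2)[of x], of "?h x"] by (simp add: D_def)
  have "C * vol f + C * vol g = (\<integral>\<^sup>+x. ennreal (trunc (f x)) + ennreal (trunc (g x)) \<partial>lborel)"
    by (subst nn_integral_add) (simp_all add: int f g)
  also have "\<dots> = (\<integral>\<^sup>+x. 2 * ennreal (trunc (?h x)) + ennreal (D x) \<partial>lborel)"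
  proof (intro nn_integral_cong)
    fix x
    have "2 * ennreal (trunc (?h x)) + ennreal (D x) = ennreal (2 * trunc (?h x) + D x)"
      using D[of x] trunc_nonneg[of "?h x"] by (simp add: ennreal_mult' ennreal_plus)
    also have "\<dots> = ennreal (trunc (f x)) + ennreal (trunc (g x))"
      by (simp add: D_def trunc_nonneg flip: ennreal_plus)
    finally show "ennreal (trunc (f x)) + ennreal (trunc (g x)) =
        2 * ennreal (trunc (?h x)) + ennreal (D x)" ..
  qed
  also have "\<dots> = 2 * (C * vol ?h) + (\<integral>\<^sup>+x. ennreal (D x) \<partial>lborel)"
    by (subst nn_integral_add) (simp_all add: nn_integral_cmult int h)
  finally have eq: "C * (vol f + vol g) = C * (2 * vol ?h) + (\<integral>\<^sup>+x. ennreal (D x) \<partial>lborel)"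
    by (simp add: distrib_left mult_ac)
  have "(\<integral>\<^sup>+x. ennreal (D x) \<partial>lborel) \<noteq> 0"
  proof
    assume "(\<integral>\<^sup>+x. ennreal (D x) \<partial>lborel) = 0"
    then have "AE x in lborel. ennreal (D x) = 0"
      by (subst (asm) nn_integral_0_iff_AE) auto
    then have "AE x in lborel. \<not> D x > 0"
      by eventually_elim (simp add: ennreal_eq_0_iff)
    then have "AE x in lebesgue. x \<notin> {x. D x > 0}"
      by (simp add: AE_completion)
    moreover have "open {x. D x > 0}"
      unfolding D_def
      by (intro open_Collect_less continuous_intros continuous_on_forms[OF f] continuous_on_forms[OF g]
          continuous_on_compose2[OF continuous_on_trunc[of UNIV]]) auto
    ultimately have empty: "{x. D x > 0} = {}"
      using open_not_negligible by (metis negligible_iff_null_sets AE_iff_null_sets borel_open sets_completionI_sets sets_lborel)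
    \<comment> \<open>The scaling factor makes the values of the two forms add up to 2, so that they lie on
      different sides of 1.\<close>
    obtain x where "f x \<noteq> g x" using \<open>f \<noteq> g\<close> by blast
    define s where "s = (2 / (f x + g x)) powr (1 / real d)"
    have pos: "f x + g x > 0"
      using nonneg(1)[of x] nonneg(2)[of x] \<open>f x \<noteq> g x\<close> by linarith
    then have s: "s ^ d = 2 / (f x + g x)"
      using \<open>d > 0\<close> by (simp add: s_def powr_powr flip: powr_realpow)
    let ?y = "s *\<^sub>R x"
    have val: "f ?y = 2 * f x / (f x + g x)" "g ?y = 2 * g x / (f x + g x)"
      by (simp_all add: forms_homogeneous[OF f] forms_homogeneous[OF g] s)
    have "D ?y > 0"
    proof (cases "f x < g x")
      case True
      then have "f ?y < 1" "1 < g ?y" using pos by (simp_all add: val)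
      from trunc_midpoint_less[OF nonneg(1) this, of "?h ?y"] show ?thesis by (simp add: D_def)
    next
      case False
      then have "g ?y < 1" "1 < f ?y" using pos \<open>f x \<noteq> g x\<close> by (simp_all add: val)
      from trunc_midpoint_less[OF nonneg(2) this, of "?h ?y"] show ?thesis by (simp add: D_def)
    qed
    with empty show False by blast
  qed
  moreover have "C * (vol f + vol g) < \<infinity>"
    using C fin by (simp add: ennreal_mult_less_top)
  ultimately have "C * (2 * vol ?h) < C * (vol f + vol g)"
    unfolding eq by (simp add: ennreal_add_left_cancel_less[of _ 0, simplified] zero_less_iff_neq_zero less_top)
  then show ?thesis
    by (meson mult_left_mono not_le zero_le)
qed

lemma vol_lower_semicontinuous:
  fixes F :: "nat \<Rightarrow> real ^ 'n::finite \<Rightarrow> real"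
  assumes F: "\<And>k. F k \<in> forms d" and f: "f \<in> forms d" and "d > 0"
    and conv: "\<And>x. (\<lambda>k. F k x) \<longlonglongrightarrow> f x" and lim: "(\<lambda>k. vol (F k)) \<longlonglongrightarrow> v"
  shows "vol f \<le> v"
proof -
  obtain C :: ennreal where C: "0 < C" "C < \<infinity>"
    and int: "\<And>f :: real ^ 'n \<Rightarrow> real. f \<in> forms d \<Longrightarrow> (\<integral>\<^sup>+x. ennreal (trunc (f x)) \<partial>lborel) = C * vol f"
    using integral_trunc_form[OF \<open>d > 0\<close>] by metis
  have [measurable]: "F k \<in> borel_measurable borel" for k by (rule borel_measurable_forms[OF F])
  have tends: "(\<lambda>k. ennreal (trunc (F k x))) \<longlonglongrightarrow> ennreal (trunc (f x))" for x
    by (intro tendsto_ennrealI continuous_on_tendsto_compose[OF continuous_on_trunc[of UNIV] conv]) auto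
  have "C * vol f = (\<integral>\<^sup>+x. liminf (\<lambda>k. ennreal (trunc (F k x))) \<partial>lborel)"
    using lim_imp_Liminf[OF _ tends] by (simp add: int[OF f, symmetric])
  also have "\<dots> \<le> liminf (\<lambda>k. C * vol (F k))"
    using nn_integral_liminf[of "\<lambda>k x. ennreal (trunc (F k x))" lborel] by (simp add: int[OF F])
  also have "\<dots> = C * v"
    using C by (intro lim_imp_Liminf ennreal_tendsto_cmult lim) auto
  finally show ?thesis using C by (simp add: ennreal_mult_le_mult_iff)
qed

section \<open>Invariance of the volume under orthogonal maps\<close>

lemma nn_integral_lborel_translate_reflect:
  fixes h :: "'a::euclidean_space \<Rightarrow> ennreal"
  assumes [measurable]: "h \<in> borel_measurable borel" and "\<bar>c\<bar> = 1"
  shows "(\<integral>\<^sup>+x. h (t + c *\<^sub>R x) \<partial>lborel) = (\<integral>\<^sup>+x. h x \<partial>lborel)"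
proof -
  have "c \<noteq> 0" using assms(2) by auto
  then have "(lborel :: 'a measure) = distr lborel borel (\<lambda>x. t + c *\<^sub>R x)"
    using lborel_affine[of c t] assms(2) by (simp add: density_1)
  then have "(\<integral>\<^sup>+x. h x \<partial>lborel) = (\<integral>\<^sup>+x. h x \<partial>distr lborel borel (\<lambda>x. t + c *\<^sub>R x))" by simp
  then show ?thesis by (simp add: nn_integral_distr)
qed

text \<open>The argument behind the uniqueness of Haar measure. By Tonelli's theorem and translation invariance,
  \<open>\<mu>(B) \<mu>(g\<^sup>-\<^sup>1 A)\<close> and \<open>\<mu>(A) \<mu>(g\<^sup>-\<^sup>1 B)\<close> are the same double integral. The unit ball \<open>B\<close> satisfies
  \<open>g\<^sup>-\<^sup>1 B = B\<close> and has positive finite measure, which can be cancelled.\<close>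

lemma emeasure_lborel_orthogonal_vimage:
  fixes g :: "'a::euclidean_space \<Rightarrow> 'a"
  assumes g: "orthogonal_transformation g" and [measurable]: "A \<in> sets borel"
  shows "emeasure lborel (g -` A) = emeasure lborel A"
proof -
  define B :: "'a set" where "B = ball 0 1"
  have [measurable]: "B \<in> sets borel" by (simp add: B_def)
  have lin: "linear g" using g by (rule orthogonal_transformation_linear)
  then have [measurable]: "g \<in> borel_measurable borel"
    by (intro borel_measurable_continuous_onI linear_continuous_on) (simp add: linear_conv_bounded_linear)
  note translate = nn_integral_lborel_translate_reflect[where c = 1, simplified]
  have gB: "g -` B = B"
    using g by (auto simp: B_def orthogonal_transformation_norm)
  have [measurable]: "g -` A \<in> sets borel" and "g -` B \<in> sets borel"
    using measurable_sets_borel[of g borel A] measurable_sets_borel[of g borel B] by auto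
  have "emeasure lborel B * emeasure lborel (g -` A) =
      (\<integral>\<^sup>+x. emeasure lborel B * indicator (g -` A) x \<partial>lborel)"
    by (simp add: nn_integral_cmult_indicator)
  also have "\<dots> = (\<integral>\<^sup>+x. (\<integral>\<^sup>+y. indicator A (g x) * indicator B y \<partial>lborel) \<partial>lborel)"
  proof (intro nn_integral_cong)
    fix x
    show "emeasure lborel B * indicator (g -` A) x = (\<integral>\<^sup>+y. indicator A (g x) * indicator B y \<partial>lborel)"
      by (subst nn_integral_cmult_indicator) (auto simp: indicator_vimage mult.commute)
  qed
  also have "\<dots> = (\<integral>\<^sup>+x. (\<integral>\<^sup>+y. indicator A (g x) * indicator B (g x + y) \<partial>lborel) \<partial>lborel)"
    by (intro nn_integral_cong translate[symmetric]) measurable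
  also have "\<dots> = (\<integral>\<^sup>+y. (\<integral>\<^sup>+x. indicator A (g x) * indicator B (g x + y) \<partial>lborel) \<partial>lborel)"
    by (intro lborel_pair.Fubini'[symmetric]) measurable
  also have "\<dots> = (\<integral>\<^sup>+y. (\<integral>\<^sup>+x. indicator A (g x - y) * indicator B (g x) \<partial>lborel) \<partial>lborel)"
  proof (rule nn_integral_cong)
    fix y
    obtain z where z: "g z = y"
      using orthogonal_transformation_surj[OF g] by (metis surjD)
    have "(\<integral>\<^sup>+x. indicator A (g x) * indicator B (g x + y) \<partial>lborel) =
        (\<integral>\<^sup>+x. indicator A (g (- z + x)) * indicator B (g (- z + x) + y) \<partial>lborel)"
      by (rule translate[symmetric]) measurable
    also have "\<dots> = (\<integral>\<^sup>+x. indicator A (g x - y) * indicator B (g x) \<partial>lborel)"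
      by (simp add: linear_diff[OF lin] z)
    finally show "(\<integral>\<^sup>+x. indicator A (g x) * indicator B (g x + y) \<partial>lborel) =
        (\<integral>\<^sup>+x. indicator A (g x - y) * indicator B (g x) \<partial>lborel)" .
  qed
  also have "\<dots> = (\<integral>\<^sup>+x. (\<integral>\<^sup>+y. indicator A (g x - y) * indicator B (g x) \<partial>lborel) \<partial>lborel)"
    by (intro lborel_pair.Fubini') measurable
  also have "\<dots> = (\<integral>\<^sup>+x. emeasure lborel A * indicator B (g x) \<partial>lborel)"
  proof (intro nn_integral_cong)
    fix x
    have "(\<integral>\<^sup>+y. indicator A (g x - y) \<partial>lborel) = emeasure lborel A"
      using nn_integral_lborel_translate_reflect[of "indicator A" "-1" "g x"] by simp
    then show "(\<integral>\<^sup>+y. indicator A (g x - y) * indicator B (g x) \<partial>lborel) =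
        emeasure lborel A * indicator B (g x)"
      by (subst nn_integral_multc) auto
  qed
  also have "\<dots> = (\<integral>\<^sup>+x. emeasure lborel A * indicator (g -` B) x \<partial>lborel)"
    by (simp add: indicator_vimage)
  also have "\<dots> = emeasure lborel B * emeasure lborel A"
    unfolding gB by (subst nn_integral_cmult_indicator) (simp_all add: mult.commute)
  finally have "emeasure lborel B * emeasure lborel (g -` A) = emeasure lborel B * emeasure lborel A" .
  moreover have "emeasure lborel B \<noteq> \<infinity>"
    using emeasure_lborel_ball_finite[of "0::'a" 1] by (simp add: B_def less_top)
  moreover have "emeasure lborel B \<noteq> 0"
    using open_not_negligible[of B] unfolding B_def
    by (auto simp: negligible_iff_null_sets null_sets_def)
  ultimately show ?thesis by (simp add: ennreal_mult_cancel_left)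
qed

lemma matrix_inv_orthogonal:
  fixes \<rho> :: "real ^ 'n::finite ^ 'n"
  assumes "orthogonal_matrix \<rho>"
  shows "matrix_inv \<rho> = transpose \<rho>"
proof -
  have \<rho>: "\<rho> ** transpose \<rho> = mat 1" "transpose \<rho> ** \<rho> = mat 1"
    using assms by (auto simp: orthogonal_matrix_def)
  then have "\<exists>A. \<rho> ** A = mat 1 \<and> A ** \<rho> = mat 1" by blast
  then have "\<rho> ** matrix_inv \<rho> = mat 1 \<and> matrix_inv \<rho> ** \<rho> = mat 1"
    unfolding matrix_inv_def by (rule someI_ex)
  then show ?thesis using \<rho> by (metis matrix_mul_assoc matrix_mul_lid matrix_mul_rid)
qed

section \<open>Optimal solutions\<close>

context
  fixes d :: nat and N :: "(real ^ 'n::finite \<Rightarrow> real) \<Rightarrow> real"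
  assumes d: "even d" "d \<ge> 2" and N: "norm_on_forms d N"
begin

lemma norm_power_norm_pos: "N (norm_power d) > 0"
proof -
  have "norm_power d (axis undefined 1 :: real ^ 'n) \<noteq> 0" by (simp add: norm_power_def)
  then have "(norm_power d :: real ^ 'n \<Rightarrow> real) \<noteq> (\<lambda>x. 0)" by metis
  then show ?thesis
    using norm_nonneg[OF N] norm_eq_0_iff[OF N] norm_power_in_forms[OF d(1)]
    by (metis order_le_less)
qed

lemma normalized_norm_power:
  shows "(\<lambda>x::real ^ 'n. norm_power d x / N (norm_power d)) \<in> forms d"
    and "N (\<lambda>x. norm_power d x / N (norm_power d)) \<le> 1"
    and "vol (\<lambda>x::real ^ 'n. norm_power d x / N (norm_power d)) =
      ennreal (N (norm_power d) powr (real CARD('n) / real d)) * vol (norm_power d :: real ^ 'n \<Rightarrow> real)"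
    and "vol (\<lambda>x::real ^ 'n. norm_power d x / N (norm_power d)) < \<infinity>"
proof -
  let ?b = "norm_power d :: real ^ 'n \<Rightarrow> real"
  have b: "?b \<in> forms d" by (rule norm_power_in_forms[OF d(1)])
  show form: "(\<lambda>x. ?b x / N ?b) \<in> forms d"
    using scale_in_forms[OF b, of "1 / N ?b"] by simp
  show "N (\<lambda>x. ?b x / N ?b) \<le> 1"
    using norm_scale[OF N b, of "1 / N ?b"] norm_power_norm_pos by simp
  have "{x. ?b x / N ?b \<le> 1} = {x. ?b x \<le> N ?b}"
    using norm_power_norm_pos by simp
  then show vol: "vol (\<lambda>x. ?b x / N ?b) = ennreal (N ?b powr (real CARD('n) / real d)) * vol ?b"
    using emeasure_sublevel[OF b _ norm_power_norm_pos] d vol_lborel[OF form] by simp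
  have "{x. ?b x \<le> 1} = cball 0 1"
    using d by (auto simp: norm_power_def power_le_one_iff)
  then have "vol ?b < \<infinity>"
    using emeasure_lborel_cball_finite[of "0 :: real ^ 'n" 1] vol_lborel[OF b] by simp
  then show "vol (\<lambda>x. ?b x / N ?b) < \<infinity>"
    unfolding vol by (simp add: ennreal_mult_less_top)
qed

lemma opt_le: "f \<in> forms d \<Longrightarrow> N f \<le> 1 \<Longrightarrow> opt d N \<le> vol f"
  unfolding opt_def by (rule INF_lower) simp

lemma opt_finite: "opt d N < \<infinity>"
  using opt_le[OF normalized_norm_power(1,2)] normalized_norm_power(4) by (rule le_less_trans)

lemma optimal_solution_exists: "\<exists>f. optimal_solution d N f"
proof -
  let ?A = "vol ` {f \<in> forms d. N f \<le> 1}"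
  have "?A \<noteq> {}" using normalized_norm_power(1,2) by blast
  from Inf_as_limit[OF this]
  obtain u where u: "\<forall>k. u k \<in> ?A" and lim: "u \<longlonglongrightarrow> opt d N" unfolding opt_def by blast
  from u have "\<forall>k. \<exists>f. f \<in> forms d \<and> N f \<le> 1 \<and> u k = vol f" by blast
  from choice[OF this] obtain F
    where F: "\<And>k. F k \<in> forms d" "\<And>k. N (F k) \<le> 1" "\<And>k. u k = vol (F k)" by blast
  obtain f r
    where f: "f \<in> forms d" "N f \<le> 1" and r: "strict_mono r"
      and conv: "\<And>x. (\<lambda>k. F (r k) x) \<longlonglongrightarrow> f x"
    using unit_ball_compact[OF N, of F, OF F(1,2)] by blast
  have "vol f \<le> opt d N"
  proof (rule vol_lower_semicontinuous[OF F(1) f(1) _ conv])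
    show "(\<lambda>k. vol (F (r k))) \<longlonglongrightarrow> opt d N"
      using LIMSEQ_subseq_LIMSEQ[OF lim r] by (simp add: F(3) comp_def)
  qed (use d in simp)
  with opt_le[OF f] f show ?thesis by (auto simp: optimal_solution_def intro: antisym)
qed

lemma optimal_solution_unique:
  assumes "optimal_solution d N f" "optimal_solution d N g"
  shows "g = f"
proof (rule ccontr)
  assume "g \<noteq> f"
  let ?h = "\<lambda>x. (f x + g x) / 2"
  have f: "f \<in> forms d" "N f \<le> 1" "vol f = opt d N" and g: "g \<in> forms d" "N g \<le> 1" "vol g = opt d N"
    using assms by (auto simp: optimal_solution_def)
  have s: "(\<lambda>x. f x + g x) \<in> forms d" by (rule add_in_forms[OF f(1) g(1)])
  have "?h \<in> forms d" "N ?h \<le> 1"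
    using scale_in_forms[OF s, of "1 / 2"] norm_scale[OF N s, of "1 / 2"] norm_triangle[OF N f(1) g(1)] f(2) g(2)
    by simp_all
  from opt_le[OF this] have "2 * opt d N \<le> 2 * vol ?h" by (intro mult_left_mono) auto
  also have "\<dots> < vol f + vol g"
    using vol_midpoint_less[OF f(1) g(1)] d f(3) g(3) opt_finite \<open>g \<noteq> f\<close> by auto
  finally show False by (simp add: f(3) g(3) mult_2)
qed

lemma optimal_solution_orthogonal:
  assumes inv: "orthogonally_invariant d N" and f: "optimal_solution d N f"
    and g: "orthogonal_transformation g"
  shows "f (g x) = f x"
proof -
  let ?M = "matrix g"
  have lin: "linear g" using g by (rule orthogonal_transformation_linear)
  have M: "orthogonal_matrix (transpose ?M)"
    using g by (simp add: orthogonal_transformation_matrix)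
  have g_eq: "?M *v x = g x" for x using lin by simp
  have push: "pushforward (transpose ?M) f = (\<lambda>x. f (g x))"
    using matrix_inv_orthogonal[OF M] g_eq by (simp add: pushforward_def)
  have ff: "f \<in> forms d" using f by (simp add: optimal_solution_def)
  have form: "(\<lambda>x. f (g x)) \<in> forms d"
    using linear_substitution_in_forms[OF ff, of ?M] by (simp add: g_eq)
  have "vol (\<lambda>x. f (g x)) = emeasure lborel (g -` {x. f x \<le> 1})"
    unfolding vol_lborel[OF form] by (simp add: vimage_def)
  also have "\<dots> = vol f"
    using emeasure_lborel_orthogonal_vimage[OF g borel_sublevel[OF ff]] vol_lborel[OF ff] by simp
  finally have "vol (\<lambda>x. f (g x)) = vol f" .
  moreover have "N (\<lambda>x. f (g x)) = N f"
    using inv M ff push unfolding orthogonally_invariant_def by metis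
  ultimately have "optimal_solution d N (\<lambda>x. f (g x))"
    using f form by (simp add: optimal_solution_def)
  from optimal_solution_unique[OF f this] show ?thesis by metis
qed

lemma optimal_solution_invariant:
  assumes inv: "orthogonally_invariant d N" and f: "optimal_solution d N f"
  shows "f = (\<lambda>x. norm_power d x / N (norm_power d))"
proof -
  let ?b = "norm_power d :: real ^ 'n \<Rightarrow> real"
  have ff: "f \<in> forms d" "N f \<le> 1" "vol f = opt d N" using f by (auto simp: optimal_solution_def)
  define e :: "real ^ 'n" where "e = axis undefined 1"
  have radial: "f x = f e * ?b x" for x
  proof -
    have "norm (norm x *\<^sub>R e) = norm x" by (simp add: e_def)
    then obtain g where g: "orthogonal_transformation g" "g (norm x *\<^sub>R e) = x"
      by (rule orthogonal_transformation_exists)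
    have "f x = f (norm x *\<^sub>R e)"
      using optimal_solution_orthogonal[OF inv f g(1), of "norm x *\<^sub>R e"] g(2) by simp
    then show ?thesis by (simp add: forms_homogeneous[OF ff(1)] norm_power_def)
  qed
  have "\<bar>f e\<bar> * N ?b \<le> 1"
    using ff(2) norm_scale[OF N norm_power_in_forms[OF d(1)], of "f e"] by (simp flip: radial)
  then have "f e * N ?b \<le> 1"
    using norm_power_norm_pos by (smt (verit) mult_right_mono)
  then have "f e \<le> 1 / N ?b" using norm_power_norm_pos by (simp add: field_simps)
  then have le: "f x \<le> ?b x / N ?b" for x
    unfolding radial[of x] using mult_right_mono[of "f e" "1 / N ?b" "?b x"] by (simp add: norm_power_def)
  have "vol (\<lambda>x. ?b x / N ?b) \<le> vol f"
    unfolding vol_lborel[OF ff(1)] vol_lborel[OF normalized_norm_power(1)]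
    using borel_sublevel[OF ff(1)] by (intro emeasure_mono) (auto intro: order_trans[OF le])
  then have "optimal_solution d N (\<lambda>x. ?b x / N ?b)"
    using opt_le normalized_norm_power(1,2) ff(3) by (auto simp: optimal_solution_def intro: antisym)
  from optimal_solution_unique[OF this f] show ?thesis .
qed

end

theorem mainTheorem1:
  fixes d :: nat and N :: "(real ^ 'n::finite \<Rightarrow> real) \<Rightarrow> real"
  assumes "even d" and "d \<ge> 2" and "norm_on_forms d N"
  shows "\<exists>f. optimal_solution d N f
           \<and> (\<forall>g. optimal_solution d N g \<longrightarrow> g = f)
           \<and> f \<in> finite_vol_forms d
           \<and> (orthogonally_invariant d N \<longrightarrow>
                f = (\<lambda>x. norm_power d x / N (norm_power d))
                \<and> opt d N = ennreal (N (norm_power d) powr (real CARD('n) / real d))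
                              * vol (norm_power d :: real ^ 'n \<Rightarrow> real))"
proof -
  obtain f where f: "optimal_solution d N f"
    using optimal_solution_exists[OF assms] by blast
  have "f \<in> finite_vol_forms d"
    using f opt_finite[OF assms] by (simp add: finite_vol_forms_def optimal_solution_def)
  moreover have "f = (\<lambda>x. norm_power d x / N (norm_power d))
      \<and> opt d N = ennreal (N (norm_power d) powr (real CARD('n) / real d))
          * vol (norm_power d :: real ^ 'n \<Rightarrow> real)" if inv: "orthogonally_invariant d N"
  proof -
    have eq: "f = (\<lambda>x. norm_power d x / N (norm_power d))"
      by (rule optimal_solution_invariant[OF assms inv f])
    have "opt d N = vol f" using f by (simp add: optimal_solution_def)
    with eq normalized_norm_power(3)[OF assms] show ?thesis by metis
  qed
  ultimately show ?thesis using f optimal_solution_unique[OF assms f] by blast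
qed

end
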